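(* Let $n \ge 3$, let $B \subset \mathbb{R}^{n-1}$ be an open Euclidean ball centered at the origin, let $f : B \to \mathbb{R}$ be a function, and let $\Theta \subset \mathbb{R}^n$ be a non-empty open set. Assume that for all $\theta=(\theta_1,\ldots,\theta_n) \in \Theta$ and for every affinely independent $y_1,\ldots,y_n \in B$ such that $\sum_{i=1}^n \theta_i y_i = 0$, it holds that $\sum_{i=1}^n \theta_i f(y_i) = 0$. Then $f$ is a linear function on $B \setminus \{0\}$, i.e. $f$ coincides on $B\setminus\{0\}$ with a linear functional on $\mathbb{R}^{n-1}$.
   Context: No continuity or measurability of $f$ is assumed. *)

theory Defs
  imports "HOL-Analysis.Analysis"
begin

end

theory Submission
  imports Defs
begin

text \<open>
  Fix a \<open>\<theta> \<in> \<Theta>\<close> with \<open>\<theta> $ k \<noteq> 0\<close> and nonzero coordinate sum. Freezing the points \<open>y i\<close> with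
  \<open>i \<noteq> k\<close> and moving the coordinates of \<open>\<theta>\<close> other than the \<open>k\<close>-th lets \<open>y k\<close> sweep out a
  neighbourhood of its initial position, and the hypothesis says that there \<open>f\<close> agrees with the
  linear functional sending each frozen \<open>y i\<close> to \<open>f (y i)\<close>. If some \<open>j \<noteq> k\<close> has
  \<open>\<bar>\<theta> $ j\<bar> \<ge> \<bar>\<theta> $ k\<bar>\<close>, the frozen points can be chosen in the ball so that \<open>y k\<close> is any
  prescribed nonzero point of it. Thus \<open>f\<close> is locally linear on the punctured ball, which is
  connected, and so the local functionals all coincide.
\<close>

text \<open>A linear map is its own derivative, so each local functional is the derivative of
  \<open>f\<close> at every point of its neighbourhood. Uniqueness of derivatives then makes the
  chosen functional locally constant, hence constant on a connected set.\<close>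

lemma locally_linear_imp_linear_on_connected:
  fixes f :: "'a::euclidean_space \<Rightarrow> real"
  assumes "open S" "connected S"
    and loc: "\<And>x. x \<in> S \<Longrightarrow> \<exists>L U. linear L \<and> open U \<and> x \<in> U \<and> (\<forall>z\<in>U. f z = L z)"
  shows "\<exists>L. linear L \<and> (\<forall>x\<in>S. f x = L x)"
proof (cases "S = {}")
  case True
  then show ?thesis using linear_zero by blast
next
  case False
  then obtain b where b: "b \<in> S" by blast
  obtain L U where LU: "\<And>x. x \<in> S \<Longrightarrow> linear (L x) \<and> open (U x) \<and> x \<in> U x \<and> (\<forall>z\<in>U x. f z = L x z)"
    using loc by metis
  have deriv: "(f has_derivative L x) (at z)" if "x \<in> S" "z \<in> U x" for x z
    by (rule has_derivative_transform_within_open[where f = "L x" and s = "U x"])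
      (use LU[OF that(1)] that in \<open>auto intro: linear_imp_has_derivative\<close>)
  have "L constant_on S"
  proof (rule locally_constant_imp_constant[OF \<open>connected S\<close>])
    fix a assume a: "a \<in> S"
    have "L z = L a" if "z \<in> S \<inter> U a" for z
      using that a deriv[of z z] deriv[of a z] LU[of z] has_derivative_unique by blast
    moreover have "openin (top_of_set S) (S \<inter> U a)" "a \<in> S \<inter> U a"
      using a LU[OF a] by (simp_all add: openin_open_Int)
    ultimately show "\<exists>T. openin (top_of_set S) T \<and> a \<in> T \<and> (\<forall>x\<in>T. L x = L a)"
      by blast
  qed
  then have "L x = L b" if "x \<in> S" for x
    using that b by (metis constant_on_def)
  then show ?thesis
    using LU b by metis
qed

text \<open>A coincidence \<open>y p = y q\<close> is itself a forbidden relation, with coefficients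
  1 at \<open>p\<close> and -1 at \<open>q\<close>. Once \<open>y\<close> is injective, coefficients
  on the range pull back along \<open>y\<close> to coefficients on the index type.\<close>

lemma affine_independent_familyI:
  fixes y :: "'n::finite \<Rightarrow> 'a::real_vector"
  assumes indep: "\<And>c. (\<Sum>i\<in>UNIV. c i) = 0 \<Longrightarrow> (\<Sum>i\<in>UNIV. c i *\<^sub>R y i) = 0 \<Longrightarrow> \<forall>i. c i = 0"
  shows "inj y" and "\<not> affine_dependent (range y)"
proof -
  show inj: "inj y"
  proof (rule injI, rule ccontr)
    fix p q assume eq: "y p = y q" and ne: "p \<noteq> q"
    define c where "c i = (if i = p then 1 else 0) - (if i = q then 1 else (0::real))" for i
    have "(\<Sum>i\<in>UNIV. c i) = 0"
      by (simp add: c_def sum_subtractf)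
    moreover have "(\<Sum>i\<in>UNIV. c i *\<^sub>R y i) = 0"
      by (simp add: c_def scaleR_diff_left sum_subtractf if_distrib[of "\<lambda>t. t *\<^sub>R _"] eq cong: if_cong)
    ultimately have "c p = 0" using indep by blast
    then show False using ne by (simp add: c_def)
  qed
  show "\<not> affine_dependent (range y)"
  proof
    assume "affine_dependent (range y)"
    then obtain u where u: "sum u (range y) = 0" "\<exists>v\<in>range y. u v \<noteq> 0"
      "(\<Sum>v\<in>range y. u v *\<^sub>R v) = 0"
      by (subst (asm) affine_dependent_explicit_finite) auto
    then show False
      using indep[of "u \<circ> y"] inj by (auto simp: sum.reindex)
  qed
qed

text \<open>
  A perturbation of a rank-one map: \<open>c \<mapsto> (1 - e) (c $ j / a $ j) x + e P c\<close>, with \<open>P\<close> a scaled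
  rotation taking \<open>a\<close> to \<open>x\<close> and \<open>e\<close> small.
\<close>
lemma exists_linear_bij_small_on_axes:
  fixes a x :: "real ^ 'm"
  assumes aj: "\<bar>a $ j\<bar> \<ge> 1" and "x \<noteq> 0" and xr: "norm x < r"
  obtains M where "linear M" "inj M" "M a = x" "\<And>i. norm (M (axis i 1)) < r"
proof -
  have a0: "a \<noteq> 0" "a $ j \<noteq> 0" using aj by auto
  obtain Q where Q: "orthogonal_transformation Q" "Q a = (norm a / norm x) *\<^sub>R x"
    using orthogonal_transformation_exists[of a "(norm a / norm x) *\<^sub>R x"] \<open>x \<noteq> 0\<close> by auto
  define C where "C = norm x / norm a"
  have "C > 0" using a0 \<open>x \<noteq> 0\<close> by (simp add: C_def)
  define P where "P c = C *\<^sub>R Q c" for c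
  have linQ: "linear Q" and normQ: "\<And>v. norm (Q v) = norm v"
    using Q(1) by (auto simp: orthogonal_transformation)
  have linP: "linear P"
    using linQ unfolding P_def[abs_def] by (rule linear_compose_scale_right)
  have Pa: "P a = x" using a0 \<open>x \<noteq> 0\<close> by (simp add: P_def Q C_def)
  have P0: "c = 0" if "P c = 0" for c
    using that \<open>C > 0\<close> normQ[of c] by (simp add: P_def)
  \<comment> \<open>This \<open>e\<close> solves \<open>e * C = (1 - e) * (r - norm x)\<close>, so
    the bound \<open>(1 - e) * norm x + e * C\<close> on the images of the axis vectors equals
    \<open>(1 - e) * r\<close>.\<close>
  define e where "e = (r - norm x) / (r - norm x + C)"
  have e: "0 < e" "e < 1" and eC: "e * C < r - norm x + e * norm x"
  proof -
    show "0 < e" "e < 1" using xr \<open>C > 0\<close> by (auto simp: e_def field_simps)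
    have "e * C = (1 - e) * (r - norm x)"
      using xr \<open>C > 0\<close> by (simp add: e_def field_simps)
    also have "\<dots> < r - norm x" using \<open>0 < e\<close> xr by (simp add: algebra_simps)
    finally show "e * C < r - norm x + e * norm x" using \<open>0 < e\<close>
      by (smt (verit) mult_nonneg_nonneg norm_ge_zero)
  qed
  define M where "M c = ((1 - e) * (c $ j / a $ j)) *\<^sub>R x + e *\<^sub>R P c" for c
  have linM: "linear M"
    unfolding M_def[abs_def]
    by (rule linearI) (simp_all add: linear_add[OF linP] linear_cmul[OF linP] algebra_simps add_divide_distrib)
  show thesis
  proof
    show "linear M" by (fact linM)
    show "M a = x" using a0 by (simp add: M_def Pa flip: scaleR_left_distrib)
    have "c = 0" if "M c = 0" for c
    proof -
      \<comment> \<open>Since \<open>x = P a\<close>, the value \<open>M c\<close> is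
        \<open>P (s *\<^sub>R a + e *\<^sub>R c)\<close>. The \<open>j\<close>-th coordinate of that
        argument is exactly \<open>c $ j\<close>, so \<open>M c = 0\<close> forces first
        \<open>c $ j = 0\<close>, then \<open>s = 0\<close>, then \<open>c = 0\<close>.\<close>
      define s where "s = (1 - e) * (c $ j / a $ j)"
      have "P (s *\<^sub>R a + e *\<^sub>R c) = 0"
        using that by (simp add: M_def s_def linear_add[OF linP] linear_cmul[OF linP] Pa)
      then have z: "s *\<^sub>R a + e *\<^sub>R c = 0" by (rule P0)
      then have "(s *\<^sub>R a + e *\<^sub>R c) $ j = 0" by simp
      moreover have "s * a $ j = (1 - e) * c $ j" using a0 by (simp add: s_def)
      ultimately have "c $ j = 0" by (simp add: algebra_simps)
      then have "s = 0" by (simp add: s_def)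
      then show "c = 0" using z e by simp
    qed
    then show "inj M" using linM by (simp add: linear_injective_0)
    fix i
    have "\<bar>axis i 1 $ j / a $ j\<bar> \<le> 1"
      using aj by (auto simp: axis_def)
    from mult_left_mono[OF this, of "(1 - e) * norm x"]
    have "norm (((1 - e) * (axis i 1 $ j / a $ j)) *\<^sub>R x) \<le> (1 - e) * norm x"
      using e by (simp add: abs_mult mult_ac)
    moreover have "norm (e *\<^sub>R P (axis i 1)) = e * C"
      using e \<open>C > 0\<close> by (simp add: P_def normQ)
    ultimately have "norm (M (axis i 1)) \<le> (1 - e) * norm x + e * C"
      unfolding M_def by (smt (verit) norm_triangle_ineq)
    also have "\<dots> < r" using eC by (simp add: algebra_simps)
    finally show "norm (M (axis i 1)) < r" .
  qed
qed

text \<open>Along the diagonal line through a point of \<Theta>, each of the three conditions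
  excludes a single parameter, while the parameters staying in \<Theta> form a nonempty open, hence
  infinite, set.\<close>

lemma open_vec_generic_point:
  fixes \<Theta> :: "(real ^ 'n) set"
  assumes "open \<Theta>" "\<Theta> \<noteq> {}"
  obtains \<theta> where "\<theta> \<in> \<Theta>" "\<theta> $ p \<noteq> 0" "\<theta> $ q \<noteq> 0" "(\<Sum>i\<in>UNIV. \<theta> $ i) \<noteq> 0"
proof -
  obtain t where t: "t \<in> \<Theta>" using assms by blast
  let ?T = "(\<lambda>s::real. t + s *\<^sub>R 1) -` \<Theta>"
  have "open ?T"
    using \<open>open \<Theta>\<close> by (intro open_vimage continuous_intros)
  moreover have "0 \<in> ?T" using t by simp
  ultimately have "infinite ?T"
    using finite_imp_not_open by blast
  then have "\<not> ?T \<subseteq> {- t $ p, - t $ q, - (\<Sum>i\<in>UNIV. t $ i) / CARD('n)}"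
    using finite_subset by blast
  then obtain s where s: "s \<in> ?T" "s \<noteq> - t $ p" "s \<noteq> - t $ q" "s \<noteq> - (\<Sum>i\<in>UNIV. t $ i) / CARD('n)"
    by blast
  show thesis
  proof (rule that[of "t + s *\<^sub>R 1"])
    show "(\<Sum>i\<in>UNIV. (t + s *\<^sub>R 1) $ i) \<noteq> 0"
      using s(4) by (simp add: sum.distrib field_simps add_eq_0_iff)
  qed (use s in \<open>auto simp: add_eq_0_iff\<close>)
qed

lemma locally_linear_of_balanced_identity:
  fixes f :: "real ^ 'm \<Rightarrow> real" and \<Theta> :: "(real ^ 'n) set"
  assumes card: "CARD('n) = Suc CARD('m)" and "open \<Theta>"
    and \<theta>: "\<theta> \<in> \<Theta>" "\<theta> $ k \<noteq> 0" "(\<Sum>i\<in>UNIV. \<theta> $ i) \<noteq> 0" and jk: "j \<noteq> k" "\<bar>\<theta> $ j\<bar> \<ge> \<bar>\<theta> $ k\<bar>"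
    and x: "x \<noteq> 0" "norm x < r"
    and hyp: "\<And>\<theta> (y :: 'n \<Rightarrow> real ^ 'm). \<theta> \<in> \<Theta> \<Longrightarrow> (\<forall>i. norm (y i) < r) \<Longrightarrow>
           inj y \<Longrightarrow> \<not> affine_dependent (range y) \<Longrightarrow>
           (\<Sum>i\<in>UNIV. \<theta> $ i *\<^sub>R y i) = 0 \<Longrightarrow> (\<Sum>i\<in>UNIV. \<theta> $ i * f (y i)) = 0"
  shows "\<exists>L U. linear L \<and> open U \<and> x \<in> U \<and> (\<forall>z\<in>U. f z = L z)"
proof -
  have "card (UNIV :: 'm set) = card (UNIV - {k})"
    using card by (simp add: card_Diff_singleton)
  then obtain e :: "'m \<Rightarrow> 'n" where e: "bij_betw e UNIV (UNIV - {k})"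
    using finite_same_card_bij[of "UNIV :: 'm set" "UNIV - {k}"] by auto
  \<comment> \<open>The value \<open>d k\<close> is arbitrary; below, \<open>d\<close> is only
    evaluated at indices other than \<open>k\<close>.\<close>
  define d where "d = inv e"
  have ed: "e (d i) = i" if "i \<noteq> k" for i
    using e that unfolding d_def by (metis DiffI UNIV_I bij_betw_def f_inv_into_f singletonD)
  have ek: "e p \<noteq> k" for p using e unfolding bij_betw_def by auto
  have de: "d (e p) = p" for p
    using e unfolding d_def by (simp add: bij_betw_def)
  have split: "(\<Sum>i\<in>UNIV. g i) = g k + (\<Sum>p\<in>UNIV. g (e p))" for g :: "'n \<Rightarrow> 'c::comm_monoid_add"
    by (subst sum.reindex_bij_betw[OF e]) (simp add: sum.remove)
  define a :: "real ^ 'm" where "a = (\<chi> p. - (\<theta> $ e p / \<theta> $ k))"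
  have "\<bar>a $ d j\<bar> \<ge> 1"
    using jk \<theta> by (simp add: a_def ed)
  then obtain M where M: "linear M" "inj M" "M a = x" "\<And>p. norm (M (axis p 1)) < r"
    using exists_linear_bij_small_on_axes x by metis
  obtain N where N: "linear N" "\<And>v. N (M v) = v" "\<And>v. M (N v) = v"
    using linear_injective_isomorphism[OF M(1,2)] by metis
  have Msum: "M c = (\<Sum>p\<in>UNIV. c $ p *\<^sub>R M (axis p 1))" for c
    by (subst basis_expansion[symmetric, of c])
      (simp add: linear_sum[OF M(1)] linear_cmul[OF M(1)] scalar_mult_eq_scaleR)
  define \<theta>' :: "real ^ 'm \<Rightarrow> real ^ 'n" where
    "\<theta>' z = (\<chi> i. if i = k then \<theta> $ k else - (\<theta> $ k * N z $ d i))" for z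
  have \<theta>'k: "\<theta>' z $ k = \<theta> $ k" and \<theta>'e: "\<theta>' z $ e p = - (\<theta> $ k * N z $ p)" for z p
    using ek by (auto simp: \<theta>'_def de)
  have contN: "continuous_on UNIV N"
    using N(1) by (simp add: linear_continuous_on linear_conv_bounded_linear)
  have cont: "continuous_on UNIV \<theta>'"
    unfolding \<theta>'_def[abs_def]
  proof (intro continuous_on_vec_lambda)
    fix i
    show "continuous_on UNIV (\<lambda>z. if i = k then \<theta> $ k else - (\<theta> $ k * N z $ d i))"
      by (cases "i = k") (auto intro!: continuous_intros contN)
  qed
  have "N x = a" using N(2)[of a] M(3) by simp
  then have \<theta>'x: "\<theta>' x = \<theta>"
    using \<theta>(2) by (auto simp: \<theta>'_def a_def vec_eq_iff ed)
  \<comment> \<open>The nonzero weight sum is an open condition, imposed to make the points affinely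
    independent.\<close>
  define U where "U = \<theta>' -` \<Theta> \<inter> {z. (\<Sum>i\<in>UNIV. \<theta>' z $ i) \<noteq> 0} \<inter> ball 0 r"
  have "open U"
    unfolding U_def using \<open>open \<Theta>\<close> cont
    by (intro open_Int open_vimage open_Collect_neq continuous_intros open_ball) auto
  moreover have "x \<in> U"
    using \<theta> x by (simp add: U_def \<theta>'x)
  moreover define L where "L z = (\<Sum>p\<in>UNIV. N z $ p * f (M (axis p 1)))" for z
  have "linear L"
    unfolding L_def[abs_def]
    by (rule linearI) (simp_all add: linear_add[OF N(1)] linear_cmul[OF N(1)]
        algebra_simps sum.distrib sum_distrib_left)
  moreover have "f z = L z" if z: "z \<in> U" for z
  proof -
    define y where "y i = (if i = k then z else M (axis (d i) 1))" for i
    have yk: "y k = z" and ye: "y (e p) = M (axis p 1)" for p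
      using ek by (auto simp: y_def de)
    have bal: "(\<Sum>i\<in>UNIV. \<theta>' z $ i *\<^sub>R y i) = 0"
    proof -
      have "(\<Sum>i\<in>UNIV. \<theta>' z $ i *\<^sub>R y i) = \<theta> $ k *\<^sub>R z - \<theta> $ k *\<^sub>R M (N z)"
        by (simp add: split yk ye \<theta>'k \<theta>'e Msum[of "N z"] scaleR_sum_right sum_negf)
      then show ?thesis by (simp add: N(3))
    qed
    have indep: "\<forall>i. c i = 0" if c: "(\<Sum>i\<in>UNIV. c i) = 0" "(\<Sum>i\<in>UNIV. c i *\<^sub>R y i) = 0" for c
    proof -
      define s where "s = c k / \<theta> $ k"
      define c' where "c' i = c i - s * \<theta>' z $ i" for i
      have c'k: "c' k = 0" using \<theta>(2) by (simp add: c'_def s_def \<theta>'k)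
      have "(\<Sum>i\<in>UNIV. c' i *\<^sub>R y i) = (\<Sum>i\<in>UNIV. c i *\<^sub>R y i) - s *\<^sub>R (\<Sum>i\<in>UNIV. \<theta>' z $ i *\<^sub>R y i)"
        by (simp add: c'_def scaleR_diff_left sum_subtractf scaleR_sum_right)
      then have "(\<Sum>i\<in>UNIV. c' i *\<^sub>R y i) = 0" using c(2) bal by simp
      then have "M (\<chi> p. c' (e p)) = 0"
        by (simp add: split c'k ye Msum[of "\<chi> p. c' (e p)"])
      then have "(\<chi> p. c' (e p)) = 0"
        using M(1,2) by (simp add: linear_injective_0)
      then have "c' (e p) = 0" for p by (simp add: vec_eq_iff)
      then have "c' i = 0" for i using c'k ed by metis
      then have eq: "c i = s * \<theta>' z $ i" for i by (simp add: c'_def)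
      then have "s * (\<Sum>i\<in>UNIV. \<theta>' z $ i) = 0" using c(1) by (simp add: sum_distrib_left)
      then have "s = 0" using z by (simp add: U_def)
      then show ?thesis using eq by simp
    qed
    have "norm (y i) < r" for i
      using z M(4) by (simp add: y_def U_def)
    then have "(\<Sum>i\<in>UNIV. \<theta>' z $ i * f (y i)) = 0"
      using hyp[of "\<theta>' z" y] affine_independent_familyI[of y] indep bal z by (auto simp: U_def)
    then have "\<theta> $ k * (f z - L z) = 0"
      by (simp add: split yk ye \<theta>'k \<theta>'e L_def sum_negf sum_distrib_left algebra_simps)
    then show ?thesis using \<theta>(2) by simp
  qed
  ultimately show ?thesis by blast
qed

theorem lemma1p14:
  fixes n :: nat
    and r :: real
    and B :: "(real ^ 'm) set"
    and f :: "real ^ 'm \<Rightarrow> real"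
    and \<Theta> :: "(real ^ 'n) set"
  assumes "n \<ge> 3"
    and "CARD('n) = n"
    and "CARD('m) = n - 1"
    and "r > 0"
    and "B = ball 0 r"
    and "open \<Theta>"
    and "\<Theta> \<noteq> {}"
    and "\<And>\<theta> (y :: 'n \<Rightarrow> real ^ 'm).
           \<theta> \<in> \<Theta> \<Longrightarrow> (\<forall>i. y i \<in> B) \<Longrightarrow>
           inj y \<Longrightarrow> \<not> affine_dependent (range y) \<Longrightarrow>
           (\<Sum>i\<in>UNIV. (\<theta> $ i) *\<^sub>R y i) = 0 \<Longrightarrow>
           (\<Sum>i\<in>UNIV. (\<theta> $ i) * f (y i)) = 0"
  shows "\<exists>L :: real ^ 'm \<Rightarrow> real. linear L \<and> (\<forall>x \<in> B - {0}. f x = L x)"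
proof -
  have card: "CARD('n) = Suc CARD('m)" and "CARD('m) \<ge> 2"
    using assms(1-3) by auto
  have "2 \<le> card (UNIV :: 'n set)"
    using assms(1,2) by simp
  then obtain p q :: 'n where "p \<noteq> q"
    by (metis UNIV_I card_2_iff' ex_card)
  obtain \<theta> where \<theta>: "\<theta> \<in> \<Theta>" "\<theta> $ p \<noteq> 0" "\<theta> $ q \<noteq> 0" "(\<Sum>i\<in>UNIV. \<theta> $ i) \<noteq> 0"
    using open_vec_generic_point assms(6,7) by metis
  \<comment> \<open>Take for \<open>k\<close> whichever of \<open>p\<close> and \<open>q\<close> has
    the smaller weight in modulus, and for \<open>j\<close> the other.\<close>
  obtain j k where jk: "\<theta> $ k \<noteq> 0" "j \<noteq> k" "\<bar>\<theta> $ j\<bar> \<ge> \<bar>\<theta> $ k\<bar>"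
    using \<theta>(2,3) \<open>p \<noteq> q\<close> by (metis linear)
  have loc: "\<exists>L U. linear L \<and> open U \<and> x \<in> U \<and> (\<forall>z\<in>U. f z = L z)" if "x \<in> B - {0}" for x
    by (rule locally_linear_of_balanced_identity[OF card assms(6) \<theta>(1) jk(1) \<theta>(4) jk(2,3)])
      (use that assms(5,8) in auto)
  show ?thesis
  proof (rule locally_linear_imp_linear_on_connected[OF _ _ loc])
    show "open (B - {0})" using assms(5) by (simp add: open_delete)
    \<comment> \<open>This is where \<open>n \<ge> 3\<close> enters: a punctured ball is
      disconnected in dimension 1.\<close>
    show "connected (B - {0})"
      using \<open>CARD('m) \<ge> 2\<close> assms(5) by (simp add: connected_punctured_ball)
  qed
qed

end
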